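(* Let $n\ge 1$ and fix $T>0$. Let $u$ be a positive solution of $$\partial_t u-\Delta u=0\quad\text{in }\mathbb{R}^n\times(0,T)$$ such that $u$ has bounded $x$-gradient, i.e. $Du\in L^\infty(\mathbb{R}^n\times(0,T))$, and $x$-derivatives up to fourth order in $L^2$, i.e. $\partial_x^\alpha u\in L^2(\mathbb{R}^n\times(0,T))$ for all multi-indices $|\alpha|\le 4$. Then for any $\tau\in(0,T)$ the following matrix estimate holds on $\mathbb{R}^n$: $$D^2\log u(\cdot,\tau)\ \geq\ -\frac{1}{2\tau}\,\mathbb{I}_n,$$ and, in particular, $$\Delta(\log u)(\cdot,\tau)=\frac{\partial_t u(\cdot,\tau)}{u(\cdot,\tau)}-\frac{|Du(\cdot,\tau)|^2}{u^2(\cdot,\tau)}\ \geq\ -\frac{n}{2\tau}.$$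
   Context: $Du$, $D^2u$, $\Delta u$ denote the gradient, Hessian and Laplacian with respect to the spatial variable $x$ only. $\mathbb{I}_n$ is the $n\times n$ identity matrix, and matrix inequalities are in the sense of quadratic forms of symmetric matrices. Solutions of the heat equation are classical ($C^\infty$ for $t>0$) and are assumed to extend continuously up to $t=0$. *)

theory Defs
  imports "HOL-Analysis.Analysis"
begin

text \<open>Functions of space and time are written \<open>u x t\<close>, with \<open>x :: real ^ 'n\<close> and \<open>t :: real\<close>.
  The slice \<open>\<lambda>y. u y t\<close> is the function of the space variable alone to which the
  spatial operators below are applied.\<close>

definition spacetime :: "real \<Rightarrow> ((real ^ 'n) \<times> real) set" where
  "spacetime T = UNIV \<times> {0<..<T}"

definition partial :: "'n \<Rightarrow> (real ^ 'n \<Rightarrow> real) \<Rightarrow> real ^ 'n \<Rightarrow> real" where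
  "partial i g x = deriv (\<lambda>h. g (x + h *\<^sub>R axis i 1)) 0"

text \<open>A spatial derivative of order \<open>k\<close> is given by a list of \<open>k\<close> coordinate indices;
  the multi-index \<open>\<alpha>\<close> corresponds to the lists in which each \<open>i\<close> occurs \<open>\<alpha> i\<close> times.
  For smooth functions the order of the list is immaterial.\<close>

primrec partials :: "'n list \<Rightarrow> (real ^ 'n \<Rightarrow> real) \<Rightarrow> real ^ 'n \<Rightarrow> real" where
  "partials [] g = g"
| "partials (i # is) g = partial i (partials is g)"

definition grad :: "(real ^ 'n \<Rightarrow> real) \<Rightarrow> real ^ 'n \<Rightarrow> real ^ 'n" where
  "grad g x = (\<chi> i. partial i g x)"

definition hessian :: "(real ^ 'n \<Rightarrow> real) \<Rightarrow> real ^ 'n \<Rightarrow> real ^ 'n ^ 'n" where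
  "hessian g x = (\<chi> i j. partial i (partial j g) x)"

definition laplacian :: "(real ^ 'n \<Rightarrow> real) \<Rightarrow> real ^ 'n \<Rightarrow> real" where
  "laplacian g x = (\<Sum>i\<in>UNIV. partial i (partial i g) x)"

definition symmetric_matrix :: "real ^ 'n ^ 'n \<Rightarrow> bool" where
  "symmetric_matrix A \<longleftrightarrow> transpose A = A"

definition matrix_le :: "real ^ 'n ^ 'n \<Rightarrow> real ^ 'n ^ 'n \<Rightarrow> bool" where
  "matrix_le A B \<longleftrightarrow> symmetric_matrix A \<and> symmetric_matrix B \<and>
     (\<forall>v. v \<bullet> (A *v v) \<le> v \<bullet> (B *v v))"

text \<open>\<open>C\<^sup>k\<close> and \<open>C\<^sup>\<infinity>\<close> regularity on an open set \<open>S\<close>.\<close>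

primrec Ck_on :: "nat \<Rightarrow> 'a::euclidean_space set \<Rightarrow> ('a \<Rightarrow> real) \<Rightarrow> bool" where
  "Ck_on 0 S f \<longleftrightarrow> continuous_on S f"
| "Ck_on (Suc k) S f \<longleftrightarrow> (\<forall>x\<in>S. f differentiable (at x)) \<and>
     (\<forall>b\<in>Basis. Ck_on k S (\<lambda>x. frechet_derivative f (at x) b))"

definition smooth_on :: "'a::euclidean_space set \<Rightarrow> ('a \<Rightarrow> real) \<Rightarrow> bool" where
  "smooth_on S f \<longleftrightarrow> (\<forall>k. Ck_on k S f)"

text \<open>Classical solutions on \<open>\<real>\<^sup>n \<times> (0,T)\<close>, continuous up to \<open>t = 0\<close>;
  the values \<open>u x 0\<close> are those of the continuous extension.\<close>

definition heat_solution :: "real \<Rightarrow> (real ^ 'n \<Rightarrow> real \<Rightarrow> real) \<Rightarrow> bool" where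
  "heat_solution T u \<longleftrightarrow>
     smooth_on (spacetime T) (\<lambda>(x, t). u x t) \<and>
     continuous_on (UNIV \<times> {0..<T}) (\<lambda>(x, t). u x t) \<and>
     (\<forall>x. \<forall>t\<in>{0<..<T}. deriv (\<lambda>s. u x s) t - laplacian (\<lambda>y. u y t) x = 0)"

definition in_L2 :: "'a::euclidean_space set \<Rightarrow> ('a \<Rightarrow> real) \<Rightarrow> bool" where
  "in_L2 S f \<longleftrightarrow> f \<in> borel_measurable (lebesgue_on S) \<and>
     integrable (lebesgue_on S) (\<lambda>p. (f p)\<^sup>2)"

definition in_Linf ::
  "'a::euclidean_space set \<Rightarrow> ('a \<Rightarrow> 'b::euclidean_space) \<Rightarrow> bool" where
  "in_Linf S f \<longleftrightarrow> f \<in> borel_measurable (lebesgue_on S) \<and>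
     (\<exists>C. AE p in lebesgue_on S. norm (f p) \<le> C)"

end

theory Submission
  imports Defs
begin

text \<open>The product of \<open>exp (\<xi> \<bullet> x / 2 + \<bar>\<xi>\<bar>\<^sup>2 t / 4)\<close> and \<open>u (x + t \<xi>) t\<close> solves the
  heat equation for every vector \<open>\<xi>\<close> (Galilean invariance). Taking \<open>\<xi>\<close> and \<open>-\<xi>\<close>, with weights
  \<open>a\<close> and \<open>1/a\<close>, and subtracting \<open>2 u\<close>, one gets a solution that is nonnegative at \<open>t = 0\<close> by the
  inequality between arithmetic and geometric mean, and that is bounded below by a function of
  linear growth because \<open>u\<close> is positive and has bounded gradient. By the maximum principle it is
  nonnegative for all times. Optimising in \<open>a\<close>, and writing \<open>z = t \<xi>\<close>, this says that
  \<open>2 ln u(x,t) \<le> ln u(x+z,t) + ln u(x-z,t) + \<bar>z\<bar>\<^sup>2 / (2t)\<close>, whose second order expansion at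
  \<open>z = 0\<close> is the matrix estimate.\<close>

section \<open>Directional derivatives\<close>

lemma DERIV_along_line:
  fixes f f' :: "'a::real_normed_vector \<Rightarrow> real"
  assumes "\<And>y. ((\<lambda>h. f (y + h *\<^sub>R v)) has_real_derivative f' y) (at 0)"
  shows "((\<lambda>h. f (y + h *\<^sub>R v)) has_real_derivative f' (y + s *\<^sub>R v)) (at s)"
proof -
  have "((\<lambda>h. f ((y + s *\<^sub>R v) + h *\<^sub>R v)) has_real_derivative f' (y + s *\<^sub>R v)) (at 0)"
    by (rule assms)
  then have "((\<lambda>h. f (y + (h + s) *\<^sub>R v)) has_real_derivative f' (y + s *\<^sub>R v)) (at 0)"
    by (simp add: algebra_simps)
  then show ?thesis
    using DERIV_shift[of "\<lambda>h. f (y + h *\<^sub>R v)" _ 0 s] by simp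
qed

text \<open>The mean value theorem is applied twice: first in direction \<open>a\<close> to the
  increment of \<open>f\<close> over \<open>h *\<^sub>R b\<close>, then in direction
  \<open>b\<close> to \<open>fa\<close>. The left side is symmetric in \<open>a\<close> and
  \<open>b\<close>, which is what makes it useful for comparing the two orders of
  differentiation.\<close>

lemma mixed_difference_quotient:
  fixes f fa fab :: "'a::real_normed_vector \<Rightarrow> real"
  assumes fa: "\<And>y. ((\<lambda>h. f (y + h *\<^sub>R a)) has_real_derivative fa y) (at 0)"
    and fab: "\<And>y. ((\<lambda>h. fa (y + h *\<^sub>R b)) has_real_derivative fab y) (at 0)"
    and "0 < h"
  obtains s r where "0 < s" "s < h" "0 < r" "r < h"
    "f (x + h *\<^sub>R a + h *\<^sub>R b) - f (x + h *\<^sub>R a) - f (x + h *\<^sub>R b) + f x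
      = h * h * fab (x + s *\<^sub>R a + r *\<^sub>R b)"
proof -
  have "\<And>s. ((\<lambda>s. f ((x + h *\<^sub>R b) + s *\<^sub>R a) - f (x + s *\<^sub>R a)) has_real_derivative
      fa ((x + h *\<^sub>R b) + s *\<^sub>R a) - fa (x + s *\<^sub>R a)) (at s)"
    by (intro DERIV_diff DERIV_along_line[OF fa])
  from MVT2[OF \<open>0 < h\<close> this] obtain s where s: "0 < s" "s < h"
    and 1: "(f ((x + h *\<^sub>R b) + h *\<^sub>R a) - f (x + h *\<^sub>R a)) - (f (x + h *\<^sub>R b) - f x)
      = h * (fa ((x + h *\<^sub>R b) + s *\<^sub>R a) - fa (x + s *\<^sub>R a))"
    by auto
  have "\<And>r. ((\<lambda>r. fa ((x + s *\<^sub>R a) + r *\<^sub>R b)) has_real_derivative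
      fab ((x + s *\<^sub>R a) + r *\<^sub>R b)) (at r)"
    by (rule DERIV_along_line[OF fab])
  from MVT2[OF \<open>0 < h\<close> this] obtain r where r: "0 < r" "r < h"
    and 2: "fa ((x + s *\<^sub>R a) + h *\<^sub>R b) - fa (x + s *\<^sub>R a) = h * fab (x + s *\<^sub>R a + r *\<^sub>R b)"
    by auto
  have "fa ((x + h *\<^sub>R b) + s *\<^sub>R a) - fa (x + s *\<^sub>R a) = h * fab (x + s *\<^sub>R a + r *\<^sub>R b)"
    using 2 by (simp add: algebra_simps)
  with 1 have "f (x + h *\<^sub>R a + h *\<^sub>R b) - f (x + h *\<^sub>R a) - f (x + h *\<^sub>R b) + f x
      = h * h * fab (x + s *\<^sub>R a + r *\<^sub>R b)"
    by (simp add: algebra_simps)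
  with s r show ?thesis by (rule that)
qed

text \<open>Schwarz's theorem for directional derivatives: the second difference divided by
  \<open>h * h\<close> is a value of \<open>fab\<close> and also a value of \<open>fba\<close>, both
  taken near \<open>x\<close>, so continuity at \<open>x\<close> forces the two to agree
  there.\<close>

lemma mixed_derivatives_commute:
  fixes f fa fb fab fba :: "'a::real_normed_vector \<Rightarrow> real"
  assumes fa: "\<And>y. ((\<lambda>h. f (y + h *\<^sub>R a)) has_real_derivative fa y) (at 0)"
    and fab: "\<And>y. ((\<lambda>h. fa (y + h *\<^sub>R b)) has_real_derivative fab y) (at 0)"
    and fb: "\<And>y. ((\<lambda>h. f (y + h *\<^sub>R b)) has_real_derivative fb y) (at 0)"
    and fba: "\<And>y. ((\<lambda>h. fb (y + h *\<^sub>R a)) has_real_derivative fba y) (at 0)"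
    and cont: "isCont fab x" "isCont fba x"
  shows "fab x = fba x"
proof (rule ccontr)
  assume "fab x \<noteq> fba x"
  define e where "e = \<bar>fab x - fba x\<bar> / 2"
  have "0 < e" using \<open>fab x \<noteq> fba x\<close> by (simp add: e_def)
  obtain d1 where d1: "d1 > 0" "\<And>y. dist y x < d1 \<Longrightarrow> dist (fab y) (fab x) < e"
    using cont(1) \<open>0 < e\<close> unfolding continuous_at_eps_delta by blast
  obtain d2 where d2: "d2 > 0" "\<And>y. dist y x < d2 \<Longrightarrow> dist (fba y) (fba x) < e"
    using cont(2) \<open>0 < e\<close> unfolding continuous_at_eps_delta by blast
  define d where "d = min d1 d2"
  define N where "N = norm a + norm b + 1"
  have N: "N > 0" by (simp add: N_def add_nonneg_pos)
  \<comment> \<open>With this size the whole parallelogram spanned by \<open>h *\<^sub>R a\<close>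
    and \<open>h *\<^sub>R b\<close> stays in the ball where both continuity estimates hold. The
    summand 1 in \<open>N\<close> makes the bound strict and covers
    \<open>a = b = 0\<close>.\<close>
  define h where "h = d / N"
  have "h > 0" using d1(1) d2(1) N by (simp add: h_def d_def)
  have close: "dist (x + s *\<^sub>R a + r *\<^sub>R b) x < d"
    if "0 < s" "s < h" "0 < r" "r < h" for s r
  proof -
    have "norm (s *\<^sub>R a + r *\<^sub>R b) \<le> s * norm a + r * norm b"
      using that norm_triangle_ineq[of "s *\<^sub>R a" "r *\<^sub>R b"] by simp
    also have "\<dots> \<le> h * norm a + h * norm b"
      using that by (intro add_mono mult_right_mono) auto
    also have "\<dots> < h * N" using \<open>h > 0\<close> by (simp add: N_def algebra_simps)
    also have "\<dots> = d" using N by (simp add: h_def)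
    finally show ?thesis by (simp add: dist_norm add.assoc)
  qed
  obtain s r where sr: "0 < s" "s < h" "0 < r" "r < h"
    "f (x + h *\<^sub>R a + h *\<^sub>R b) - f (x + h *\<^sub>R a) - f (x + h *\<^sub>R b) + f x
      = h * h * fab (x + s *\<^sub>R a + r *\<^sub>R b)"
    by (rule mixed_difference_quotient[of f a fa b fab h x, OF fa fab \<open>0 < h\<close>])
  obtain s' r' where sr': "0 < s'" "s' < h" "0 < r'" "r' < h"
    "f (x + h *\<^sub>R b + h *\<^sub>R a) - f (x + h *\<^sub>R b) - f (x + h *\<^sub>R a) + f x
      = h * h * fba (x + s' *\<^sub>R b + r' *\<^sub>R a)"
    by (rule mixed_difference_quotient[of f b fb a fba h x, OF fb fba \<open>0 < h\<close>])
  have "h * h * fab (x + s *\<^sub>R a + r *\<^sub>R b) = h * h * fba (x + r' *\<^sub>R a + s' *\<^sub>R b)"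
    using sr(5) sr'(5) by (simp add: algebra_simps)
  then have eq: "fab (x + s *\<^sub>R a + r *\<^sub>R b) = fba (x + r' *\<^sub>R a + s' *\<^sub>R b)"
    using \<open>h > 0\<close> by simp
  have "\<bar>fab (x + s *\<^sub>R a + r *\<^sub>R b) - fab x\<bar> < e"
    using d1(2) close[OF sr(1-4)] by (simp add: d_def dist_real_def)
  moreover have "\<bar>fab (x + s *\<^sub>R a + r *\<^sub>R b) - fba x\<bar> < e"
    using d2(2) close[OF sr'(3,4,1,2)] by (simp add: eq d_def dist_real_def)
  ultimately have "\<bar>fab x - fba x\<bar> < 2 * e" by linarith
  then show False by (simp add: e_def)
qed

text \<open>At the minimum \<open>g1 x = 0\<close>. If \<open>g2 < 0\<close>, then \<open>g1\<close>
  is negative just to the right of \<open>x\<close>, and the mean value theorem gives a point there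
  with a value below \<open>g x\<close>.\<close>

lemma second_derivative_nonneg_at_min:
  fixes g g1 :: "real \<Rightarrow> real"
  assumes g: "\<And>h. (g has_real_derivative g1 h) (at h)"
    and g1: "(g1 has_real_derivative g2) (at x)"
    and "0 < d" and min: "\<And>h. \<bar>h - x\<bar> < d \<Longrightarrow> g x \<le> g h"
  shows "0 \<le> g2"
proof (rule ccontr)
  assume "\<not> 0 \<le> g2"
  have "g1 x = 0"
    by (rule DERIV_local_min[OF g[of x] \<open>0 < d\<close>]) (simp add: min abs_minus_commute)
  then obtain e where e: "e > 0" "\<And>h. 0 < h \<Longrightarrow> h < e \<Longrightarrow> g1 (x + h) < 0"
    using DERIV_neg_dec_right[OF g1] \<open>\<not> 0 \<le> g2\<close> by (metis not_le)
  define h where "h = min d e / 2"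
  have h: "0 < h" "h < d" "h < e" using \<open>0 < d\<close> \<open>0 < e\<close> by (auto simp: h_def)
  have "x < x + h" using h by simp
  obtain z where z: "x < z" "z < x + h" "g (x + h) - g x = (x + h - x) * g1 z"
    using MVT2[OF \<open>x < x + h\<close> g] by blast
  have "g1 z < 0" using e(2)[of "z - x"] z h by simp
  then have "h * g1 z < 0" by (rule mult_pos_neg[OF h(1)])
  then have "g (x + h) - g x < 0" unfolding z(3) by simp
  then have "g (x + h) < g x" by simp
  then show False using min[of "x + h"] h by simp
qed

section \<open>Partial derivatives\<close>

lemma has_derivative_imp_line:
  assumes "(g has_derivative g') (at x)"
  shows "((\<lambda>h. g (x + h *\<^sub>R v)) has_real_derivative g' v) (at 0)"
proof -
  have "((\<lambda>h. x + h *\<^sub>R v) has_derivative (\<lambda>h. h *\<^sub>R v)) (at 0)"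
    by (auto intro!: derivative_eq_intros)
  then have "((\<lambda>h. g (x + h *\<^sub>R v)) has_derivative (\<lambda>h. g' (h *\<^sub>R v))) (at 0)"
    using has_derivative_compose[of "\<lambda>h. x + h *\<^sub>R v" _ 0 UNIV g g'] assms by simp
  moreover have "(\<lambda>h. g' (h *\<^sub>R v)) = (*) (g' v)"
    using linear_scale[OF has_derivative_linear[OF assms]] by (auto simp: mult.commute)
  ultimately show ?thesis by (simp add: has_field_derivative_def)
qed

lemma partial_eq:
  assumes "(g has_derivative g') (at x)"
  shows "partial i g x = g' (axis i 1)"
  unfolding partial_def by (rule DERIV_imp_deriv[OF has_derivative_imp_line[OF assms]])

lemma has_derivative_grad:
  fixes g :: "real ^ 'n \<Rightarrow> real"
  assumes "g differentiable (at x)"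
  shows "(g has_derivative (\<lambda>v. v \<bullet> grad g x)) (at x)"
proof -
  obtain g' where g': "(g has_derivative g') (at x)"
    using assms by (auto simp: differentiable_def)
  note lin = has_derivative_linear[OF g']
  have "g' v = v \<bullet> grad g x" for v
  proof -
    have "g' v = g' (\<Sum>i\<in>UNIV. v $ i *\<^sub>R axis i 1)"
      using basis_expansion[of v] by (simp add: scalar_mult_eq_scaleR)
    also have "\<dots> = (\<Sum>i\<in>UNIV. v $ i * g' (axis i 1))"
      by (simp only: linear_sum[OF lin] linear_scale[OF lin] real_scaleR_def)
    finally show ?thesis
      by (simp add: inner_vec_def grad_def partial_eq[OF g'])
  qed
  then have "g' = (\<lambda>v. v \<bullet> grad g x)" by auto
  with g' show ?thesis by simp
qed

lemma DERIV_line_grad: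
  fixes g :: "real ^ 'n \<Rightarrow> real"
  assumes "\<And>y. g differentiable (at y)"
  shows "((\<lambda>h. g (x + h *\<^sub>R v)) has_real_derivative v \<bullet> grad g (x + s *\<^sub>R v)) (at s)"
  by (rule DERIV_along_line[OF has_derivative_imp_line[OF has_derivative_grad[OF assms]]])

lemma DERIV_partial:
  fixes g :: "real ^ 'n \<Rightarrow> real"
  assumes "g differentiable (at x)"
  shows "((\<lambda>h. g (x + h *\<^sub>R axis i 1)) has_real_derivative partial i g x) (at 0)"
  using has_derivative_imp_line[OF has_derivative_grad[OF assms], of "axis i 1"]
  by (simp add: inner_axis' grad_def)

text \<open>This identifies the quadratic form of the matrix of iterated partials with the second
  derivative along the line in direction \<open>v\<close>, so that one-variable arguments apply to
  matrix bounds.\<close>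

lemma hessian_quadratic_form:
  fixes g :: "real ^ 'n \<Rightarrow> real"
  assumes "\<And>i. partial i g differentiable (at x)"
  shows "((\<lambda>h. v \<bullet> grad g (x + h *\<^sub>R v)) has_real_derivative v \<bullet> (hessian g x *v v)) (at 0)"
proof -
  have "((\<lambda>h. \<Sum>j\<in>UNIV. v $ j * partial j g (x + h *\<^sub>R v)) has_real_derivative
     (\<Sum>j\<in>UNIV. v $ j * (v \<bullet> grad (partial j g) x))) (at 0)"
    by (intro DERIV_sum DERIV_cmult has_derivative_imp_line has_derivative_grad assms)
  moreover have "(\<Sum>j\<in>UNIV. v $ j * (v \<bullet> grad (partial j g) x)) = v \<bullet> (hessian g x *v v)"
  proof -
    have "(\<Sum>j\<in>UNIV. v $ j * (v \<bullet> grad (partial j g) x))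
        = (\<Sum>j\<in>UNIV. \<Sum>i\<in>UNIV. v $ j * (v $ i * partial i (partial j g) x))"
      by (simp add: inner_vec_def grad_def sum_distrib_left)
    also have "\<dots> = (\<Sum>i\<in>UNIV. \<Sum>j\<in>UNIV. v $ j * (v $ i * partial i (partial j g) x))"
      by (rule sum.swap)
    also have "\<dots> = v \<bullet> (hessian g x *v v)"
      by (simp add: inner_vec_def hessian_def matrix_vector_mult_def sum_distrib_left mult_ac)
    finally show ?thesis .
  qed
  ultimately show ?thesis by (simp add: inner_vec_def grad_def)
qed

lemma partial_commute:
  fixes g :: "real ^ 'n \<Rightarrow> real"
  assumes "\<And>y. g differentiable (at y)"
    and "\<And>i y. partial i g differentiable (at y)"
    and "\<And>i j. continuous_on UNIV (partial i (partial j g))"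
  shows "partial i (partial j g) x = partial j (partial i g) x"
  using assms
  by (intro mixed_derivatives_commute[of g "axis j 1" "partial j g" "axis i 1"
        "partial i (partial j g)" "partial i g"])
    (auto intro!: DERIV_partial simp: continuous_on_eq_continuous_at)

lemma partial_ln:
  fixes g :: "real ^ 'n \<Rightarrow> real"
  assumes "g differentiable (at x)" and "0 < g x"
  shows "(\<lambda>y. ln (g y)) differentiable (at x)"
    and "partial i (\<lambda>y. ln (g y)) x = partial i g x / g x"
proof -
  have "((\<lambda>y. ln (g y)) has_derivative (\<lambda>v. (v \<bullet> grad g x) / g x)) (at x)"
    using assms by (auto intro!: derivative_eq_intros has_derivative_grad simp: divide_inverse)
  then show "(\<lambda>y. ln (g y)) differentiable (at x)"
    and "partial i (\<lambda>y. ln (g y)) x = partial i g x / g x"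
    by (auto simp: differentiable_def partial_eq grad_def inner_axis')
qed

lemma partial_partial_ln:
  fixes g :: "real ^ 'n \<Rightarrow> real"
  assumes g: "\<And>y. g differentiable (at y)" and pos: "\<And>y. 0 < g y"
    and g2: "\<And>i y. partial i g differentiable (at y)"
  shows "partial j (\<lambda>y. ln (g y)) differentiable (at x)"
    and "partial i (partial j (\<lambda>y. ln (g y))) x =
      partial i (partial j g) x / g x - partial i g x * partial j g x / (g x)\<^sup>2"
proof -
  have eq: "partial j (\<lambda>y. ln (g y)) = (\<lambda>y. partial j g y / g y)"
    using partial_ln(2)[OF g pos] by auto
  have "((\<lambda>y. partial j g y / g y) has_derivative
     (\<lambda>v. (v \<bullet> grad (partial j g) x) / g x - (v \<bullet> grad g x) * partial j g x / (g x)\<^sup>2)) (at x)"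
    using pos[of x]
    by (auto intro!: derivative_eq_intros has_derivative_grad g g2
        simp: field_simps power2_eq_square)
  then show "partial j (\<lambda>y. ln (g y)) differentiable (at x)"
    and "partial i (partial j (\<lambda>y. ln (g y))) x =
      partial i (partial j g) x / g x - partial i g x * partial j g x / (g x)\<^sup>2"
    unfolding eq by (auto simp: differentiable_def partial_eq grad_def inner_axis')
qed

lemma laplacian_eq_trace_hessian: "laplacian g x = (\<Sum>i\<in>UNIV. hessian g x $ i $ i)"
  by (simp add: laplacian_def hessian_def)

section \<open>The maximum principle\<close>

text \<open>The spatial derivatives are existential witnesses instead of terms in
  \<open>partial\<close>, so a candidate is verified by exhibiting them and sums are handled
  termwise. The final time \<tau> is included, and the time derivative there is two-sided.\<close>

definition caloric :: "real \<Rightarrow> (real ^ 'n \<Rightarrow> real \<Rightarrow> real) \<Rightarrow> bool" where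
  "caloric \<tau> v \<longleftrightarrow> continuous_on (UNIV \<times> {0..\<tau>}) (\<lambda>(x, t). v x t) \<and>
     (\<exists>v1 v2. \<forall>t\<in>{0<..\<tau>}. \<forall>x.
        (\<forall>i. ((\<lambda>h. v (x + h *\<^sub>R axis i 1) t) has_real_derivative v1 i x t) (at 0) \<and>
             ((\<lambda>h. v1 i (x + h *\<^sub>R axis i 1) t) has_real_derivative v2 i x t) (at 0)) \<and>
        ((\<lambda>s. v x s) has_real_derivative (\<Sum>i\<in>UNIV. v2 i x t)) (at t))"

lemma caloric_add:
  assumes "caloric \<tau> v" and "caloric \<tau> w"
  shows "caloric \<tau> (\<lambda>x t. v x t + w x t)"
proof -
  obtain v1 v2 where v: "\<And>t x i. t \<in> {0<..\<tau>} \<Longrightarrow>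
      ((\<lambda>h. v (x + h *\<^sub>R axis i 1) t) has_real_derivative v1 i x t) (at 0)"
    "\<And>t x i. t \<in> {0<..\<tau>} \<Longrightarrow>
      ((\<lambda>h. v1 i (x + h *\<^sub>R axis i 1) t) has_real_derivative v2 i x t) (at 0)"
    "\<And>t x. t \<in> {0<..\<tau>} \<Longrightarrow> ((\<lambda>s. v x s) has_real_derivative (\<Sum>i\<in>UNIV. v2 i x t)) (at t)"
    using assms(1) unfolding caloric_def by metis
  obtain w1 w2 where w: "\<And>t x i. t \<in> {0<..\<tau>} \<Longrightarrow>
      ((\<lambda>h. w (x + h *\<^sub>R axis i 1) t) has_real_derivative w1 i x t) (at 0)"
    "\<And>t x i. t \<in> {0<..\<tau>} \<Longrightarrow>
      ((\<lambda>h. w1 i (x + h *\<^sub>R axis i 1) t) has_real_derivative w2 i x t) (at 0)"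
    "\<And>t x. t \<in> {0<..\<tau>} \<Longrightarrow> ((\<lambda>s. w x s) has_real_derivative (\<Sum>i\<in>UNIV. w2 i x t)) (at t)"
    using assms(2) unfolding caloric_def by metis
  have "continuous_on (UNIV \<times> {0..\<tau>}) (\<lambda>(x, t). v x t + w x t)"
    using assms unfolding caloric_def case_prod_beta by (intro continuous_intros) auto
  then show ?thesis
    unfolding caloric_def
    by (intro conjI exI[of _ "\<lambda>i x t. v1 i x t + w1 i x t"]
        exI[of _ "\<lambda>i x t. v2 i x t + w2 i x t"] ballI allI)
      (simp_all add: sum.distrib DERIV_add v w)
qed

text \<open>On the unbounded domain, adding a small multiple of
  \<open>(norm x)\<^sup>2 + c * t\<close> beats the linear lower bound for large \<open>x\<close>. A
  negative minimum over a large cylinder is then attained off its base and its lateral boundary,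
  where the derivative tests contradict the heat equation.\<close>

lemma maximum_principle:
  fixes w :: "real ^ 'n \<Rightarrow> real \<Rightarrow> real"
  assumes cal: "caloric \<tau> w"
    and init: "\<And>x. 0 \<le> w x 0"
    and growth: "\<And>x t. t \<in> {0<..\<tau>} \<Longrightarrow> - (A + B * norm x) \<le> w x t"
    and AB: "0 \<le> A" "0 \<le> B"
    and t1: "t1 \<in> {0..\<tau>}"
  shows "0 \<le> w x1 t1"
proof (rule ccontr)
  assume "\<not> 0 \<le> w x1 t1"
  then have neg: "w x1 t1 < 0" by simp
  obtain w1 w2 where w: "\<And>t x i. t \<in> {0<..\<tau>} \<Longrightarrow>
      ((\<lambda>h. w (x + h *\<^sub>R axis i 1) t) has_real_derivative w1 i x t) (at 0)"
    "\<And>t x i. t \<in> {0<..\<tau>} \<Longrightarrow>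
      ((\<lambda>h. w1 i (x + h *\<^sub>R axis i 1) t) has_real_derivative w2 i x t) (at 0)"
    "\<And>t x. t \<in> {0<..\<tau>} \<Longrightarrow> ((\<lambda>s. w x s) has_real_derivative (\<Sum>i\<in>UNIV. w2 i x t)) (at t)"
    using cal unfolding caloric_def by metis
  \<comment> \<open>The Laplacian of \<open>(norm x)\<^sup>2\<close> is twice the dimension; the
    extra 1 makes the added term a strict supersolution.\<close>
  define c where "c = 2 * real CARD('n) + 1"
  have "c > 0" by (simp add: c_def add_nonneg_pos)
  define M where "M = (norm x1)\<^sup>2 + c * t1 + 1"
  have "M > 0" using t1 \<open>c > 0\<close> by (simp add: M_def add_nonneg_pos)
  \<comment> \<open>Chosen so that \<open>\<epsilon> * M\<close> is half of
    \<open>- w x1 t1\<close>: the perturbation keeps the value at \<open>(x1, t1)\<close>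
    negative.\<close>
  define \<epsilon> where "\<epsilon> = - w x1 t1 / (2 * M)"
  have "\<epsilon> > 0" using neg \<open>M > 0\<close> by (simp add: \<epsilon>_def divide_neg_pos)
  define W where "W x t = w x t + \<epsilon> * ((norm x)\<^sup>2 + c * t)" for x t
  have "W x1 t1 \<le> w x1 t1 + \<epsilon> * M" using \<open>\<epsilon> > 0\<close> by (simp add: W_def M_def)
  also have "\<dots> < 0" using \<open>M > 0\<close> neg by (simp add: \<epsilon>_def)
  finally have W1: "W x1 t1 < 0" .
  \<comment> \<open>The ball must contain \<open>x1\<close> and be so large that the quadratic term
    dominates \<open>A + B * R\<close> on its boundary sphere.\<close>
  define R where "R = max (norm x1) ((A + B) / \<epsilon> + 1)"
  have R: "norm x1 \<le> R" "1 \<le> R" "A + B + \<epsilon> \<le> \<epsilon> * R"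
  proof -
    show "norm x1 \<le> R" by (simp add: R_def)
    show "1 \<le> R" using AB \<open>\<epsilon> > 0\<close> by (simp add: R_def le_max_iff_disj)
    have "(A + B) / \<epsilon> + 1 \<le> R" by (simp add: R_def)
    then have "\<epsilon> * ((A + B) / \<epsilon> + 1) \<le> \<epsilon> * R" using \<open>\<epsilon> > 0\<close> by simp
    moreover have "\<epsilon> * ((A + B) / \<epsilon> + 1) = A + B + \<epsilon>" using \<open>\<epsilon> > 0\<close> by (simp add: field_simps)
    ultimately show "A + B + \<epsilon> \<le> \<epsilon> * R" by simp
  qed
  let ?K = "cball (0::real ^ 'n) R \<times> {0..\<tau>}"
  have "compact ?K" by (intro compact_Times) auto
  moreover have "(x1, t1) \<in> ?K" using R t1 by simp
  moreover have "continuous_on ?K (\<lambda>p. W (fst p) (snd p))"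
  proof -
    have "continuous_on ?K (\<lambda>p. w (fst p) (snd p))"
      using cal unfolding caloric_def case_prod_beta by (auto intro: continuous_on_subset)
    then show ?thesis unfolding W_def by (intro continuous_intros)
  qed
  ultimately obtain p where p: "p \<in> ?K" "\<And>q. q \<in> ?K \<Longrightarrow> W (fst p) (snd p) \<le> W (fst q) (snd q)"
    using continuous_attains_inf[of ?K "\<lambda>p. W (fst p) (snd p)"] by blast
  obtain x0 t0 where "p = (x0, t0)" by (cases p)
  with p have K0: "norm x0 \<le> R" "0 \<le> t0" "t0 \<le> \<tau>"
    and min: "\<And>x t. norm x \<le> R \<Longrightarrow> 0 \<le> t \<Longrightarrow> t \<le> \<tau> \<Longrightarrow> W x0 t0 \<le> W x t"
    by auto
  have W0: "W x0 t0 < 0" using min[of x1 t1] W1 R t1 by simp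
  have "t0 \<noteq> 0"
    using W0 init[of x0] \<open>\<epsilon> > 0\<close> by (auto simp: W_def) (smt (verit) mult_nonneg_nonneg zero_le_power2)
  then have t0: "t0 \<in> {0<..\<tau>}" using K0 by auto
  \<comment> \<open>On the lateral boundary the growth bound and the choice of \<open>R\<close> give
    \<open>W x0 t0 \<ge> 0\<close>.\<close>
  have "norm x0 \<noteq> R"
  proof
    assume "norm x0 = R"
    have "A + B * R \<le> (A + B + \<epsilon>) * R"
      using AB R(2) \<open>\<epsilon> > 0\<close> mult_left_mono[of 1 R A] by (simp add: distrib_right add_increasing2)
    also have "\<dots> \<le> \<epsilon> * R * R" using R by (intro mult_right_mono) auto
    finally have "A + B * R \<le> \<epsilon> * (norm x0)\<^sup>2"
      using \<open>norm x0 = R\<close> by (simp add: power2_eq_square mult.assoc)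
    then have "0 \<le> w x0 t0 + \<epsilon> * (norm x0)\<^sup>2"
      using growth[OF t0, of x0] \<open>norm x0 = R\<close> by simp
    moreover have "0 \<le> \<epsilon> * (c * t0)" using \<open>\<epsilon> > 0\<close> \<open>c > 0\<close> K0 by simp
    ultimately show False using W0 by (simp add: W_def distrib_left)
  qed
  then have x0: "norm x0 < R" using K0 by simp

  \<comment> \<open>The left side is the time derivative of \<open>W\<close> at the minimum. Since
    \<open>t0\<close> may equal \<tau>, only earlier times are compared, which yields an inequality
    instead of a vanishing derivative.\<close>
  have "(\<Sum>i\<in>UNIV. w2 i x0 t0) + \<epsilon> * c \<le> 0"
  proof (rule ccontr)
    assume "\<not> ?thesis"
    moreover have "((\<lambda>s. W x0 s) has_real_derivative (\<Sum>i\<in>UNIV. w2 i x0 t0) + \<epsilon> * c) (at t0)"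
      unfolding W_def by (auto intro!: derivative_eq_intros w t0)
    ultimately obtain d where d: "d > 0" "\<And>h. 0 < h \<Longrightarrow> h < d \<Longrightarrow> W x0 (t0 - h) < W x0 t0"
      using DERIV_pos_inc_left[of "\<lambda>s. W x0 s"] by (metis not_le)
    define h where "h = min d t0 / 2"
    have "0 < h" "h < d" "h < t0" using d(1) t0 by (auto simp: h_def)
    with d(2)[of h] min[of x0 "t0 - h"] K0 show False by simp
  qed
  \<comment> \<open>As \<open>x0\<close> is interior to the ball, each pure second derivative of
    \<open>W\<close> is nonnegative there. Summing over \<open>i\<close> and comparing with the time
    derivative leaves \<open>\<epsilon> \<le> 0\<close>.\<close>
  moreover have "0 \<le> w2 i x0 t0 + 2 * \<epsilon>" for i
  proof (rule second_derivative_nonneg_at_min)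
    let ?g = "\<lambda>h. W (x0 + h *\<^sub>R axis i 1) t0"
    let ?g1 = "\<lambda>h. w1 i (x0 + h *\<^sub>R axis i 1) t0 + \<epsilon> * (2 * x0 $ i + 2 * h)"
    have sq: "(norm (x0 + h *\<^sub>R axis i 1))\<^sup>2 = (norm x0)\<^sup>2 + 2 * h * x0 $ i + h\<^sup>2" for h
      unfolding power2_norm_eq_inner
      by (simp add: inner_add_left inner_add_right inner_axis inner_axis' inner_axis_axis
          power2_eq_square algebra_simps)
    show "(?g has_real_derivative ?g1 h) (at h)" for h
      unfolding W_def sq
      by (auto intro!: derivative_eq_intros DERIV_along_line[OF w(1)[OF t0]] simp: algebra_simps)
    show "(?g1 has_real_derivative w2 i x0 t0 + 2 * \<epsilon>) (at 0)"
      by (auto intro!: derivative_eq_intros w t0)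
    show "0 < R - norm x0" using x0 by simp
    fix h :: real assume "\<bar>h - 0\<bar> < R - norm x0"
    then have "norm (x0 + h *\<^sub>R axis i 1) \<le> R"
      using norm_triangle_ineq[of x0 "h *\<^sub>R axis i 1"] by simp
    then show "?g 0 \<le> ?g h" using min K0 by simp
  qed
  then have "0 \<le> (\<Sum>i\<in>UNIV. w2 i x0 t0 + 2 * \<epsilon>)" by (intro sum_nonneg) auto
  then have "0 \<le> (\<Sum>i\<in>UNIV. w2 i x0 t0) + 2 * \<epsilon> * real CARD('n)"
    by (simp add: sum.distrib mult_ac)
  ultimately show False using \<open>\<epsilon> > 0\<close> by (simp add: c_def algebra_simps)
qed

section \<open>Regularity and growth of solutions\<close>

lemma has_derivative_slice:
  fixes F :: "(real ^ 'n) \<times> real \<Rightarrow> real"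
  assumes "F differentiable (at (x, t))"
  shows "((\<lambda>y. F (y, t)) has_derivative (\<lambda>v. frechet_derivative F (at (x, t)) (v, 0))) (at x)"
proof -
  have "((\<lambda>y. (y, t)) has_derivative (\<lambda>v. (v, 0))) (at x)"
    by (auto intro!: derivative_eq_intros)
  from this assms[unfolded frechet_derivative_works] show ?thesis
    by (rule has_derivative_compose)
qed

lemma partial_slice:
  fixes F :: "(real ^ 'n) \<times> real \<Rightarrow> real"
  assumes "F differentiable (at (x, t))"
  shows "partial i (\<lambda>y. F (y, t)) x = frechet_derivative F (at (x, t)) (axis i 1, 0)"
  by (rule partial_eq[OF has_derivative_slice[OF assms]])

lemma heat_solution_continuous:
  "heat_solution T u \<Longrightarrow> continuous_on (UNIV \<times> {0..<T}) (\<lambda>(x, t). u x t)"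
  by (simp add: heat_solution_def)

text \<open>Space-time smoothness is translated here into statements about the spatial operators on
  slices. The joint derivative, with the Laplacian in place of the time derivative, supplies the
  chain rule along moving points \<open>x + t *\<^sub>R \<xi>\<close>.\<close>

lemma heat_solution_regularity:
  fixes u :: "real ^ 'n \<Rightarrow> real \<Rightarrow> real"
  assumes "heat_solution T u"
  shows heat_solution_has_derivative: "\<And>x t. t \<in> {0<..<T} \<Longrightarrow>
      ((\<lambda>(y, s). u y s) has_derivative
        (\<lambda>(v, r). v \<bullet> grad (\<lambda>y. u y t) x + r * laplacian (\<lambda>y. u y t) x)) (at (x, t))"
    and heat_solution_differentiable: "\<And>x t. t \<in> {0<..<T} \<Longrightarrow>
      (\<lambda>y. u y t) differentiable (at x)"
    and heat_solution_partial_differentiable: "\<And>x t i. t \<in> {0<..<T} \<Longrightarrow>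
      partial i (\<lambda>y. u y t) differentiable (at x)"
    and heat_solution_continuous_partial_partial: "\<And>t i j. t \<in> {0<..<T} \<Longrightarrow>
      continuous_on UNIV (partial i (partial j (\<lambda>y. u y t)))"
    and heat_solution_continuous_grad:
      "continuous_on (spacetime T) (\<lambda>(x, t). grad (\<lambda>y. u y t) x)"
proof -
  define F where "F = (\<lambda>(x, t). u x t)"
  define D where "D b p = frechet_derivative F (at p) b" for b p
  have "Ck_on (Suc (Suc 0)) (spacetime T) F"
    using assms unfolding heat_solution_def smooth_on_def F_def by blast
  then have F: "\<And>p. p \<in> spacetime T \<Longrightarrow> F differentiable (at p)"
    and D: "\<And>p b. p \<in> spacetime T \<Longrightarrow> b \<in> Basis \<Longrightarrow> D b differentiable (at p)"
    and DD: "\<And>b c. b \<in> Basis \<Longrightarrow> c \<in> Basis \<Longrightarrow>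
      continuous_on (spacetime T) (\<lambda>p. frechet_derivative (D b) (at p) c)"
    by (auto simp: D_def[abs_def])
  have B: "(axis i 1 :: real ^ 'n, 0 :: real) \<in> Basis" for i
    by (simp add: Basis_prod_def axis_in_Basis_iff)
  have S: "(x, t) \<in> spacetime T" if "t \<in> {0<..<T}" for x :: "real ^ 'n" and t
    using that by (simp add: spacetime_def)
  have slice: "(\<lambda>y. u y t) = (\<lambda>y. F (y, t))" for t by (simp add: F_def)
  \<comment> \<open>Spatial partials of a slice are Frechet derivatives of \<open>F\<close> in the
    purely spatial directions \<open>(axis i 1, 0)\<close>; this reduces all slice claims to
    \<open>D\<close>.\<close>
  have p1: "partial i (\<lambda>y. u y t) = (\<lambda>y. D (axis i 1, 0) (y, t))" if "t \<in> {0<..<T}" for i t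
    unfolding slice D_def by (rule ext) (rule partial_slice[OF F[OF S[OF that]]])
  have p2: "partial j (partial i (\<lambda>y. u y t)) =
      (\<lambda>y. frechet_derivative (D (axis i 1, 0)) (at (y, t)) (axis j 1, 0))"
    if "t \<in> {0<..<T}" for i j t
    unfolding p1[OF that] by (rule ext) (rule partial_slice[OF D[OF S[OF that] B]])
  show diff: "(\<lambda>y. u y t) differentiable (at x)" if "t \<in> {0<..<T}" for x t
    unfolding slice differentiable_def using has_derivative_slice[OF F[OF S[OF that]]] by blast
  show "partial i (\<lambda>y. u y t) differentiable (at x)" if "t \<in> {0<..<T}" for x t i
    unfolding p1[OF that] differentiable_def
    using has_derivative_slice[OF D[OF S[OF that] B]] by blast
  show "continuous_on UNIV (partial i (partial j (\<lambda>y. u y t)))" if "t \<in> {0<..<T}" for t i j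
    unfolding p2[OF that]
    by (rule continuous_on_compose2[OF DD[OF B B], of UNIV "\<lambda>y. (y, t)"])
      (auto intro!: continuous_intros S that)
  show "continuous_on (spacetime T) (\<lambda>(x, t). grad (\<lambda>y. u y t) x)"
  proof -
    have "continuous_on (spacetime T) (\<lambda>p. \<chi> i. D (axis i 1, 0) p)"
      by (intro continuous_on_vec_lambda continuous_at_imp_continuous_on ballI
          differentiable_imp_continuous_within D B)
    then show ?thesis
      by (rule continuous_on_eq) (auto simp: grad_def p1 spacetime_def)
  qed
  show "((\<lambda>(y, s). u y s) has_derivative
      (\<lambda>(v, r). v \<bullet> grad (\<lambda>y. u y t) x + r * laplacian (\<lambda>y. u y t) x)) (at (x, t))"
    if t: "t \<in> {0<..<T}" for x t
  proof -
    let ?F' = "frechet_derivative F (at (x, t))"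
    have F': "(F has_derivative ?F') (at (x, t))"
      using F[OF S[OF t]] by (simp add: frechet_derivative_works)
    note lin = has_derivative_linear[OF F']
    have "((\<lambda>h. F ((x, t) + h *\<^sub>R (0, 1))) has_real_derivative ?F' (0, 1)) (at 0)"
      by (rule has_derivative_imp_line[OF F'])
    then have "((\<lambda>h. u x (h + t)) has_real_derivative ?F' (0, 1)) (at 0)"
      by (simp add: F_def add.commute)
    then have "((\<lambda>s. u x s) has_real_derivative ?F' (0, 1)) (at t)"
      using DERIV_shift[of "\<lambda>s. u x s" _ 0 t] by simp
    then have "?F' (0, 1) = deriv (\<lambda>s. u x s) t" by (rule DERIV_imp_deriv[symmetric])
    also have "\<dots> = laplacian (\<lambda>y. u y t) x" using assms t by (simp add: heat_solution_def)
    finally have time: "?F' (0, 1) = laplacian (\<lambda>y. u y t) x" .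
    have space: "?F' (v, 0) = v \<bullet> grad (\<lambda>y. u y t) x" for v
      using has_derivative_unique[OF has_derivative_slice[OF F[OF S[OF t]], of x]
          has_derivative_grad[OF diff[OF t], of x, unfolded slice]]
      unfolding slice by metis
    have "?F' (v, r) = ?F' (v, 0) + r * ?F' (0, 1)" for v r
      using linear_add[OF lin, of "(v, 0)" "r *\<^sub>R (0, 1)"]
        linear_scale[OF lin, of r "(0, 1)"] by simp
    then have "?F' = (\<lambda>(v, r). v \<bullet> grad (\<lambda>y. u y t) x + r * laplacian (\<lambda>y. u y t) x)"
      by (auto simp: time space)
    with F' show ?thesis by (simp add: F_def)
  qed
qed

text \<open>The set where an essential bound fails is open by continuity and negligible, hence
  empty. This turns the almost everywhere bound into a pointwise one.\<close>

lemma in_Linf_continuous_imp_bounded: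
  fixes G :: "'a::euclidean_space \<Rightarrow> 'b::euclidean_space"
  assumes "open S" and cont: "continuous_on S G" and "in_Linf S G"
  obtains C where "0 \<le> C" "\<And>p. p \<in> S \<Longrightarrow> norm (G p) \<le> C"
proof -
  obtain C where C: "AE p in lebesgue_on S. norm (G p) \<le> C"
    using \<open>in_Linf S G\<close> unfolding in_Linf_def by blast
  define V where "V = {p \<in> S. C < norm (G p)}"
  have "open V"
  proof -
    have "open (S \<inter> (\<lambda>p. norm (G p)) -` {C<..})"
      using \<open>open S\<close> cont by (intro continuous_open_preimage continuous_intros) auto
    then show ?thesis by (simp add: V_def Int_def vimage_def)
  qed
  have "S \<in> sets lebesgue" using \<open>open S\<close> by simp
  then have "AE p in lebesgue. p \<in> S \<longrightarrow> norm (G p) \<le> C"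
    using C by (simp add: AE_restrict_space_iff)
  then have "AE p in lebesgue. p \<notin> V" by (rule AE_mp) (auto simp: V_def)
  then have "negligible V"
    using \<open>open V\<close> by (simp add: AE_iff_null_sets negligible_iff_null_sets)
  then have "V = {}" using \<open>open V\<close> open_not_negligible by blast
  then have "norm (G p) \<le> max C 0" if "p \<in> S" for p
    using that by (force simp: V_def not_less)
  then show ?thesis by (rule that[rotated]) auto
qed

text \<open>This feeds the growth condition of \<open>maximum_principle\<close>. The gradient bound
  controls \<open>u x t - u 0 t\<close> by the mean value theorem on the segment from the origin,
  and \<open>u 0 t\<close> is bounded on the compact interval \<open>{0..\<tau>}\<close> by
  continuity up to time 0.\<close>

lemma heat_solution_linear_growth:
  fixes u :: "real ^ 'n \<Rightarrow> real \<Rightarrow> real"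
  assumes heat: "heat_solution T u"
    and "in_Linf (spacetime T) (\<lambda>(x, t). grad (\<lambda>y. u y t) x)"
    and "\<tau> < T"
  obtains A B where "0 \<le> A" "0 \<le> B" "\<And>x t. t \<in> {0<..\<tau>} \<Longrightarrow> u x t \<le> A + B * norm x"
proof -
  have "open (spacetime T :: ((real ^ 'n) \<times> real) set)"
    unfolding spacetime_def by (intro open_Times) auto
  from in_Linf_continuous_imp_bounded[OF this heat_solution_continuous_grad[OF heat] assms(2)]
  obtain C where C: "0 \<le> C"
    "\<And>p. p \<in> spacetime T \<Longrightarrow> norm ((\<lambda>(x, t). grad (\<lambda>y. u y t) x) p) \<le> C"
    by metis
  have "continuous_on {0..\<tau>} (\<lambda>t. (\<lambda>(x, t). u x t) (0, t))"
    by (rule continuous_on_compose2[OF heat_solution_continuous[OF heat]])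
      (use \<open>\<tau> < T\<close> in \<open>auto intro!: continuous_intros\<close>)
  then have "compact ((\<lambda>t. u 0 t) ` {0..\<tau>})"
    by (intro compact_continuous_image) auto
  then have "bounded ((\<lambda>t. u 0 t) ` {0..\<tau>})"
    by (rule compact_imp_bounded)
  then obtain A where "\<forall>y\<in>(\<lambda>t. u 0 t) ` {0..\<tau>}. norm y \<le> A"
    unfolding bounded_iff by blast
  then have A: "\<bar>u 0 t\<bar> \<le> A" if "t \<in> {0..\<tau>}" for t
    using that by simp
  have "u x t \<le> max A 0 + C * norm x" if t: "t \<in> {0<..\<tau>}" for x t
  proof -
    have tT: "t \<in> {0<..<T}" using t \<open>\<tau> < T\<close> by simp
    note D = DERIV_line_grad[OF heat_solution_differentiable[OF heat tT], of 0 x]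
    from MVT2[OF zero_less_one D]
    obtain z where "u (0 + 1 *\<^sub>R x) t - u (0 + 0 *\<^sub>R x) t
        = (1 - 0) * (x \<bullet> grad (\<lambda>y. u y t) (0 + z *\<^sub>R x))"
      by metis
    then have "u x t - u 0 t = x \<bullet> grad (\<lambda>y. u y t) (z *\<^sub>R x)" by simp
    also have "\<dots> \<le> norm x * norm (grad (\<lambda>y. u y t) (z *\<^sub>R x))" by (rule norm_cauchy_schwarz)
    also have "\<dots> \<le> norm x * C"
      using C(2)[of "(z *\<^sub>R x, t)"] tT by (intro mult_left_mono) (auto simp: spacetime_def)
    finally show ?thesis using A[of t] t by (simp add: mult.commute)
  qed
  then show ?thesis using that[of "max A 0" C] C(1) by simp
qed

section \<open>Galilean transforms and midpoint log-convexity\<close>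

text \<open>Both the time derivative and the Laplacian of the exponential factor multiply it by
  \<open>(norm \<xi>)\<^sup>2 / 4\<close>. Its gradient is the factor times
  \<open>\<xi> / 2\<close>, so the cross term in the Laplacian of the product matches the transport
  term \<open>\<xi> \<bullet> grad\<close> from the moving argument.\<close>

lemma caloric_galilean:
  fixes u :: "real ^ 'n \<Rightarrow> real \<Rightarrow> real"
  assumes heat: "heat_solution T u" and "\<tau> < T"
  shows "caloric \<tau> (\<lambda>x t. c * exp (\<xi> \<bullet> x / 2 + (norm \<xi>)\<^sup>2 * t / 4) * u (x + t *\<^sub>R \<xi>) t)"
proof -
  define E where "E x t = c * exp (\<xi> \<bullet> x / 2 + (norm \<xi>)\<^sup>2 * t / 4)" for x t
  define u1 where "u1 i x t = partial i (\<lambda>y. u y t) x" for i x t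
  define u2 where "u2 i x t = partial i (partial i (\<lambda>y. u y t)) x" for i x t
  define v1 where "v1 i x t = E x t * (\<xi> $ i / 2 * u (x + t *\<^sub>R \<xi>) t + u1 i (x + t *\<^sub>R \<xi>) t)" for i x t
  define v2 where "v2 i x t = E x t * ((\<xi> $ i)\<^sup>2 / 4 * u (x + t *\<^sub>R \<xi>) t
    + \<xi> $ i * u1 i (x + t *\<^sub>R \<xi>) t + u2 i (x + t *\<^sub>R \<xi>) t)" for i x t
  have "continuous_on (UNIV \<times> {0..\<tau>})
      (\<lambda>p. E (fst p) (snd p) * (\<lambda>(x, t). u x t) (fst p + snd p *\<^sub>R \<xi>, snd p))"
  proof (rule continuous_on_mult)
    show "continuous_on (UNIV \<times> {0..\<tau>}) (\<lambda>p. E (fst p) (snd p))"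
      unfolding E_def by (intro continuous_intros) auto
    show "continuous_on (UNIV \<times> {0..\<tau>})
        (\<lambda>p. (\<lambda>(x, t). u x t) (fst p + snd p *\<^sub>R \<xi>, snd p))"
      by (rule continuous_on_compose2[OF heat_solution_continuous[OF heat]])
        (use \<open>\<tau> < T\<close> in \<open>auto intro!: continuous_intros\<close>)
  qed
  moreover have
    "((\<lambda>h. E (x + h *\<^sub>R axis i 1) t * u (x + h *\<^sub>R axis i 1 + t *\<^sub>R \<xi>) t)
        has_real_derivative v1 i x t) (at 0)" (is ?A)
    "((\<lambda>h. v1 i (x + h *\<^sub>R axis i 1) t) has_real_derivative v2 i x t) (at 0)" (is ?B)
    "((\<lambda>s. E x s * u (x + s *\<^sub>R \<xi>) s) has_real_derivative (\<Sum>i\<in>UNIV. v2 i x t)) (at t)" (is ?C)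
    if "t \<in> {0<..\<tau>}" for x t i
  proof -
    have t: "t \<in> {0<..<T}" using that \<open>\<tau> < T\<close> by simp
    have swap: "x + h *\<^sub>R axis i 1 + t *\<^sub>R \<xi> = (x + t *\<^sub>R \<xi>) + h *\<^sub>R axis i 1" for h
      by (simp add: algebra_simps)
    have E: "((\<lambda>h. E (x + h *\<^sub>R axis i 1) t) has_real_derivative E x t * (\<xi> $ i / 2)) (at 0)"
      unfolding E_def
      by (auto intro!: derivative_eq_intros simp: inner_add_right inner_axis)
    have U: "((\<lambda>h. u ((x + t *\<^sub>R \<xi>) + h *\<^sub>R axis i 1) t)
        has_real_derivative u1 i (x + t *\<^sub>R \<xi>) t) (at 0)"
      unfolding u1_def by (rule DERIV_partial[OF heat_solution_differentiable[OF heat t]])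
    have U1: "((\<lambda>h. u1 i ((x + t *\<^sub>R \<xi>) + h *\<^sub>R axis i 1) t)
        has_real_derivative u2 i (x + t *\<^sub>R \<xi>) t) (at 0)"
      unfolding u1_def u2_def
      by (rule DERIV_partial[OF heat_solution_partial_differentiable[OF heat t]])
    show ?A unfolding swap
      by (rule DERIV_cong[OF DERIV_mult[OF E U]]) (simp add: v1_def algebra_simps)
    show ?B unfolding v1_def swap
      by (rule DERIV_cong[OF DERIV_mult[OF E DERIV_add[OF DERIV_cmult[OF U] U1]]])
        (simp add: v2_def algebra_simps power2_eq_square)
    \<comment> \<open>The moving point travels in the space-time direction
      \<open>(\<xi>, 1)\<close>, so the joint derivative gives the transport term plus the
      Laplacian.\<close>
    have "((\<lambda>h. (\<lambda>(y, s). u y s) ((x + t *\<^sub>R \<xi>, t) + h *\<^sub>R (\<xi>, 1))) has_real_derivative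
        \<xi> \<bullet> grad (\<lambda>y. u y t) (x + t *\<^sub>R \<xi>) + laplacian (\<lambda>y. u y t) (x + t *\<^sub>R \<xi>)) (at 0)"
      using has_derivative_imp_line[OF heat_solution_has_derivative[OF heat t, of "x + t *\<^sub>R \<xi>"],
          of "(\<xi>, 1)"] by simp
    then have "((\<lambda>h. u (x + (h + t) *\<^sub>R \<xi>) (h + t)) has_real_derivative
        \<xi> \<bullet> grad (\<lambda>y. u y t) (x + t *\<^sub>R \<xi>) + laplacian (\<lambda>y. u y t) (x + t *\<^sub>R \<xi>)) (at 0)"
      by (simp add: algebra_simps)
    then have Ut: "((\<lambda>s. u (x + s *\<^sub>R \<xi>) s) has_real_derivative
        \<xi> \<bullet> grad (\<lambda>y. u y t) (x + t *\<^sub>R \<xi>) + laplacian (\<lambda>y. u y t) (x + t *\<^sub>R \<xi>)) (at t)"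
      using DERIV_shift[of "\<lambda>s. u (x + s *\<^sub>R \<xi>) s" _ 0 t] by simp
    have Et: "((\<lambda>s. E x s) has_real_derivative E x t * ((norm \<xi>)\<^sup>2 / 4)) (at t)"
      unfolding E_def by (auto intro!: derivative_eq_intros)
    have norm_sq: "(norm \<xi>)\<^sup>2 = (\<Sum>i\<in>UNIV. (\<xi> $ i)\<^sup>2)"
      unfolding power2_norm_eq_inner by (simp add: inner_vec_def power2_eq_square)
    have "(\<Sum>i\<in>UNIV. v2 i x t) = E x t * ((norm \<xi>)\<^sup>2 / 4 * u (x + t *\<^sub>R \<xi>) t
        + (\<xi> \<bullet> grad (\<lambda>y. u y t) (x + t *\<^sub>R \<xi>) + laplacian (\<lambda>y. u y t) (x + t *\<^sub>R \<xi>)))"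
      unfolding v2_def sum_distrib_left[symmetric] sum.distrib sum_distrib_right[symmetric]
        sum_divide_distrib[symmetric]
      by (simp add: norm_sq u1_def u2_def inner_vec_def grad_def laplacian_def)
    then show ?C
      by (intro DERIV_cong[OF DERIV_mult[OF Et Ut]]) (simp add: algebra_simps)
  qed
  ultimately show ?thesis
    unfolding caloric_def E_def[symmetric] case_prod_beta fst_conv snd_conv
    by (intro conjI exI[of _ v1] exI[of _ v2]) auto
qed

text \<open>Equivalently, \<open>ln (u x \<tau>) + (norm x)\<^sup>2 / (4 * \<tau>)\<close> is
  midpoint convex in \<open>x\<close>.\<close>

lemma heat_solution_ln_midpoint:
  fixes u :: "real ^ 'n \<Rightarrow> real \<Rightarrow> real"
  assumes heat: "heat_solution T u"
    and pos: "\<And>x t. t \<in> {0<..<T} \<Longrightarrow> 0 < u x t"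
    and bdd: "in_Linf (spacetime T) (\<lambda>(x, t). grad (\<lambda>y. u y t) x)"
    and \<tau>: "\<tau> \<in> {0<..<T}"
  shows "2 * ln (u x \<tau>) \<le> ln (u (x + z) \<tau>) + ln (u (x - z) \<tau>) + (norm z)\<^sup>2 / (2 * \<tau>)"
proof -
  obtain A B where AB: "0 \<le> A" "0 \<le> B" "\<And>x t. t \<in> {0<..\<tau>} \<Longrightarrow> u x t \<le> A + B * norm x"
    using heat_solution_linear_growth[OF heat bdd, of \<tau>] \<tau> by auto
  \<comment> \<open>Positivity is given for positive times; it passes to the initial time as a weak
    inequality in the limit.\<close>
  have u0: "0 \<le> u y 0" for y
  proof -
    have "continuous_on {0..<T} (\<lambda>t. (\<lambda>(x, t). u x t) (y, t))"
      by (rule continuous_on_compose2[OF heat_solution_continuous[OF heat]])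
        (auto intro!: continuous_intros)
    then have "((\<lambda>t. u y t) \<longlongrightarrow> u y 0) (at 0 within {0..<T})"
      using \<tau> by (simp add: continuous_on_def)
    then have "((\<lambda>t. u y t) \<longlongrightarrow> u y 0) (at 0 within {0<..<T})"
      by (rule tendsto_within_subset) auto
    moreover have "at 0 within {0<..<T} \<noteq> bot"
      using \<tau> by (auto simp: at_within_eq_bot_iff closure_greaterThanLessThan)
    moreover have "eventually (\<lambda>t. 0 \<le> u y t) (at 0 within {0<..<T})"
      unfolding eventually_at_filter using pos by (auto intro!: always_eventually less_imp_le)
    ultimately show ?thesis by (intro tendsto_lowerbound[of "\<lambda>t. u y t"]) auto
  qed
  \<comment> \<open>Then the displacements at time \<tau> are exactly \<open>z\<close> and
    \<open>- z\<close>.\<close>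
  define \<xi> where "\<xi> = (1 / \<tau>) *\<^sub>R z"
  define q where "q = (norm \<xi>)\<^sup>2 * \<tau> / 4"
  define l where "l y = ln (u y \<tau>)" for y
  \<comment> \<open>The optimal weight \<open>a = exp \<beta>\<close>: it makes the two positive
    summands of \<open>w\<close> equal at \<open>(x, \<tau>)\<close>, the equality case of the
    arithmetic-geometric mean inequality.\<close>
  define \<beta> where "\<beta> = (l (x - z) - l (x + z)) / 2 - \<xi> \<bullet> x / 2"
  \<comment> \<open>The last summand is \<open>- 2 * u y s\<close>, written as the Galilean
    transform with velocity 0 so that all three summands are instances of
    \<open>caloric_galilean\<close>.\<close>
  define w where "w y s = exp \<beta> * exp (\<xi> \<bullet> y / 2 + (norm \<xi>)\<^sup>2 * s / 4) * u (y + s *\<^sub>R \<xi>) s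
    + exp (- \<beta>) * exp (- \<xi> \<bullet> y / 2 + (norm (- \<xi>))\<^sup>2 * s / 4) * u (y + s *\<^sub>R (- \<xi>)) s
    + - 2 * exp (0 \<bullet> y / 2 + (norm (0 :: real ^ 'n))\<^sup>2 * s / 4) * u (y + s *\<^sub>R 0) s" for y s
  have "0 \<le> w x \<tau>"
  proof (rule maximum_principle[where w = w and \<tau> = \<tau> and A = "2 * A" and B = "2 * B"])
    show "caloric \<tau> w"
      unfolding w_def[abs_def] using \<tau> by (intro caloric_add caloric_galilean[OF heat]) auto
    show "0 \<le> w y 0" for y
    proof -
      have "w y 0 = (exp (\<beta> + \<xi> \<bullet> y / 2) + exp (- (\<beta> + \<xi> \<bullet> y / 2)) - 2) * u y 0"
        by (simp add: w_def exp_add[symmetric] algebra_simps)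
      moreover have "2 \<le> exp (\<beta> + \<xi> \<bullet> y / 2) + exp (- (\<beta> + \<xi> \<bullet> y / 2))"
        using exp_ge_add_one_self[of "\<beta> + \<xi> \<bullet> y / 2"]
          exp_ge_add_one_self[of "- (\<beta> + \<xi> \<bullet> y / 2)"] by linarith
      ultimately show ?thesis using u0[of y] by simp
    qed
    show "- (2 * A + 2 * B * norm y) \<le> w y s" if "s \<in> {0<..\<tau>}" for y s
    proof -
      have "0 < u y' s" for y' using pos[of s y'] that \<tau> by simp
      then have "- 2 * u y s \<le> w y s" by (simp add: w_def add_nonneg_nonneg less_imp_le)
      then show ?thesis using AB(3)[OF that, of y] by simp
    qed
  qed (use AB \<tau> in auto)
  moreover have "u y \<tau> = exp (l y)" for y using pos[OF \<tau>, of y] by (simp add: l_def)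
  moreover have "\<tau> *\<^sub>R \<xi> = z" using \<tau> by (simp add: \<xi>_def)
  ultimately have "2 * exp (l x) \<le> exp \<beta> * exp (\<xi> \<bullet> x / 2 + q) * exp (l (x + z))
      + exp (- \<beta>) * exp (- \<xi> \<bullet> x / 2 + q) * exp (l (x - z))"
    by (simp add: w_def q_def)
  \<comment> \<open>By the choice of \<beta> both products have the same exponent: \<open>q\<close>
    plus the mean of \<open>l (x + z)\<close> and \<open>l (x - z)\<close>.\<close>
  also have "\<dots> = 2 * exp (q + (l (x + z) + l (x - z)) / 2)"
  proof -
    have "\<beta> + (\<xi> \<bullet> x / 2 + q) + l (x + z) = q + (l (x + z) + l (x - z)) / 2"
      "- \<beta> + (- \<xi> \<bullet> x / 2 + q) + l (x - z) = q + (l (x + z) + l (x - z)) / 2"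
      by (simp_all add: \<beta>_def field_simps)
    then show ?thesis by (simp only: exp_add[symmetric] mult_2)
  qed
  finally have "l x \<le> q + (l (x + z) + l (x - z)) / 2" by simp
  then have "2 * l x \<le> l (x + z) + l (x - z) + 2 * q" by (simp add: field_simps)
  moreover have "2 * q = (norm z)\<^sup>2 / (2 * \<tau>)"
    using \<tau> by (simp add: q_def \<xi>_def power_mult_distrib power2_eq_square divide_simps)
  ultimately show ?thesis by (simp only: l_def)
qed

text \<open>With \<open>z = h *\<^sub>R v\<close>, the midpoint inequality says that an even
  function of \<open>h\<close> has its minimum at 0. Its second derivative there is twice the
  quadratic form of the Hessian plus \<open>2 * k * (norm v)\<^sup>2\<close>.\<close>

lemma hessian_lower_bound_of_midpoint:
  fixes L :: "real ^ 'n \<Rightarrow> real"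
  assumes L: "\<And>y. L differentiable (at y)"
    and L1: "\<And>i. partial i L differentiable (at x)"
    and mid: "\<And>z. 2 * L x \<le> L (x + z) + L (x - z) + k * (norm z)\<^sup>2"
  shows "- k * (v \<bullet> v) \<le> v \<bullet> (hessian L x *v v)"
proof -
  let ?g = "\<lambda>h. L (x + h *\<^sub>R v) + L (x + h *\<^sub>R (- v)) + k * (norm v)\<^sup>2 * h\<^sup>2"
  let ?g1 = "\<lambda>h. v \<bullet> grad L (x + h *\<^sub>R v) + (- v) \<bullet> grad L (x + h *\<^sub>R (- v))
    + k * (norm v)\<^sup>2 * (2 * h)"
  have "0 \<le> v \<bullet> (hessian L x *v v) + (- v) \<bullet> (hessian L x *v (- v)) + k * (norm v)\<^sup>2 * 2"
  proof (rule second_derivative_nonneg_at_min)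
    show "(?g has_real_derivative ?g1 h) (at h)" for h
      by (rule DERIV_add[OF DERIV_add[OF DERIV_line_grad[OF L] DERIV_line_grad[OF L]]])
        (auto intro!: derivative_eq_intros)
    show "(?g1 has_real_derivative
        v \<bullet> (hessian L x *v v) + (- v) \<bullet> (hessian L x *v (- v)) + k * (norm v)\<^sup>2 * 2) (at 0)"
      by (rule DERIV_add[OF DERIV_add[OF hessian_quadratic_form[OF L1] hessian_quadratic_form[OF L1]]])
        (auto intro!: derivative_eq_intros)
    show "?g 0 \<le> ?g h" for h
      using mid[of "h *\<^sub>R v"] by (simp add: power_mult_distrib mult_ac)
  qed (rule zero_less_one)
  moreover have "(- v) \<bullet> (hessian L x *v (- v)) = v \<bullet> (hessian L x *v v)"
    using matrix_vector_mult_scaleR[of "hessian L x" "-1" v] by simp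
  ultimately show ?thesis by (simp add: power2_norm_eq_inner)
qed

section \<open>The matrix estimate and its trace\<close>

theorem mainTheorem1:
  fixes u :: "real ^ 'n \<Rightarrow> real \<Rightarrow> real" and T :: real
  assumes "0 < T"
    and "heat_solution T u"
    and "\<forall>x. \<forall>t\<in>{0<..<T}. 0 < u x t"
    and "in_Linf (spacetime T) (\<lambda>(x, t). grad (\<lambda>y. u y t) x)"
    and "\<forall>is. length is \<le> 4 \<longrightarrow>
           in_L2 (spacetime T) (\<lambda>(x, t). partials is (\<lambda>y. u y t) x)"
  shows "\<forall>\<tau>\<in>{0<..<T}. \<forall>x.
           matrix_le ((- (1 / (2 * \<tau>))) *\<^sub>R mat 1) (hessian (\<lambda>y. ln (u y \<tau>)) x) \<and>
           laplacian (\<lambda>y. ln (u y \<tau>)) x =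
             deriv (\<lambda>t. u x t) \<tau> / u x \<tau> - (norm (grad (\<lambda>y. u y \<tau>) x))\<^sup>2 / (u x \<tau>)\<^sup>2 \<and>
           laplacian (\<lambda>y. ln (u y \<tau>)) x \<ge> - (real CARD('n) / (2 * \<tau>))"
proof (intro ballI allI)
  fix \<tau> x assume \<tau>: "\<tau> \<in> {0<..<T}"
  note heat = assms(2)
  have pos: "0 < u y t" if "t \<in> {0<..<T}" for y t using assms(3) that by blast
  define g where "g y = u y \<tau>" for y
  define L where "L y = ln (g y)" for y
  have g: "g differentiable (at y)" "0 < g y" "partial i g differentiable (at y)"
    "continuous_on UNIV (partial i (partial j g))" for y i j
    using heat_solution_differentiable[OF heat \<tau>] heat_solution_partial_differentiable[OF heat \<tau>]
      heat_solution_continuous_partial_partial[OF heat \<tau>] pos[OF \<tau>]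
    unfolding g_def[abs_def] by blast+
  have L: "L differentiable (at y)" "partial i L differentiable (at y)"
    "partial i (partial j L) y
      = partial i (partial j g) y / g y - partial i g y * partial j g y / (g y)\<^sup>2" for y i j
    unfolding L_def[abs_def] by (intro partial_ln partial_partial_ln g)+
  have lower: "- (1 / (2 * \<tau>)) * (v \<bullet> v) \<le> v \<bullet> (hessian L x *v v)" for v
    by (rule hessian_lower_bound_of_midpoint[OF L(1,2)])
      (use heat_solution_ln_midpoint[OF heat pos assms(4) \<tau>] in \<open>simp add: L_def g_def\<close>)
  \<comment> \<open>Symmetry is inherited from \<open>g\<close>: in the formula for the second
    partials of \<open>L\<close> the product of first partials is symmetric, and those of
    \<open>g\<close> commute.\<close>
  have "symmetric_matrix (hessian L x)"
    unfolding symmetric_matrix_def transpose_def hessian_def vec_eq_iff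
    using partial_commute[OF g(1,3,4)] by (simp add: L(3) mult.commute)
  moreover have "symmetric_matrix ((- (1 / (2 * \<tau>))) *\<^sub>R (mat 1 :: real ^ 'n ^ 'n))"
    by (auto simp: symmetric_matrix_def transpose_def mat_def vec_eq_iff)
  moreover have "((- (1 / (2 * \<tau>))) *\<^sub>R mat 1) *v v = (- (1 / (2 * \<tau>))) *\<^sub>R v" for v :: "real ^ 'n"
    by (simp only: scaleR_matrix_vector_assoc[symmetric] matrix_vector_mul_lid)
  ultimately have "matrix_le ((- (1 / (2 * \<tau>))) *\<^sub>R mat 1) (hessian L x)"
    unfolding matrix_le_def using lower by (simp only: inner_scaleR_right) blast
  moreover have "laplacian L x = deriv (\<lambda>t. u x t) \<tau> / g x - (norm (grad g x))\<^sup>2 / (g x)\<^sup>2"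
  proof -
    have "deriv (\<lambda>t. u x t) \<tau> = laplacian g x"
      using heat \<tau> by (simp add: heat_solution_def g_def[abs_def])
    then show ?thesis
      unfolding laplacian_def L(3) sum_subtractf sum_divide_distrib[symmetric]
      by (simp add: power2_norm_eq_inner inner_vec_def grad_def)
  qed
  \<comment> \<open>Testing the quadratic form on the coordinate vectors bounds each diagonal entry;
    summing them gives the trace bound.\<close>
  moreover have "- (real CARD('n) / (2 * \<tau>)) \<le> laplacian L x"
  proof -
    have "- (1 / (2 * \<tau>)) \<le> hessian L x $ i $ i" for i
      using lower[of "axis i 1"]
      by (simp add: inner_axis' matrix_vector_mul_component inner_axis)
    then have "(\<Sum>i\<in>(UNIV :: 'n set). - (1 / (2 * \<tau>))) \<le> laplacian L x"
      unfolding laplacian_eq_trace_hessian by (intro sum_mono)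
    then show ?thesis by simp
  qed
  ultimately show "matrix_le ((- (1 / (2 * \<tau>))) *\<^sub>R mat 1) (hessian (\<lambda>y. ln (u y \<tau>)) x) \<and>
      laplacian (\<lambda>y. ln (u y \<tau>)) x =
        deriv (\<lambda>t. u x t) \<tau> / u x \<tau> - (norm (grad (\<lambda>y. u y \<tau>) x))\<^sup>2 / (u x \<tau>)\<^sup>2 \<and>
      laplacian (\<lambda>y. ln (u y \<tau>)) x \<ge> - (real CARD('n) / (2 * \<tau>))"
    unfolding L_def[abs_def] g_def[abs_def] by blast
qed

end
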